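(* Let $\mathcal{L}_d$ be a first-order language (of arbitrary cardinality) containing a binary predicate symbol $d$, and let $V$ be a Gödel set whose set $V'$ of limit points (in the order topology) satisfies $V'\subseteq\{0\}$. In the Gödel logic $\mathfrak{G}_V$, as well as in the Gödel logic $\mathfrak{G}_{V,V\setminus\{0,1\}}$, every finitely Lipschitz-satisfiable $\mathcal L_d$-theory is Lipschitz-satisfiable.
   Context: A Gödel set is a closed subset $V\subseteq[0,1]$ containing $0,1$. $\mathfrak{G}_{V,A}$ ($A\subseteq V\setminus\{0,1\}$) has connectives $\wedge,\to,\bot$, quantifiers $\forall,\exists$, and nullary connectives $\bar r$ for $r\in A$; $\mathfrak{G}_V$ is the case $A=\emptyset$. Reversed semantics ($0$ = absolute truth, $1$ = absolute falsity): $\bot^{\mathcal M}=1$, $\bar r^{\mathcal M}=r$, $(\varphi\wedge\psi)^{\mathcal M}=\max$, $(\varphi\to\psi)^{\mathcal M}=0$ if $\varphi^{\mathcal M}\ge\psi^{\mathcal M}$ and $=\psi^{\mathcal M}$ otherwise, $\forall$ = supremum, $\exists$ = infimum. $\mathcal M\models\varphi$ (sentence) iff $\varphi^{\mathcal M}=0$. On $V$ let $d_{max}(x,y)=0$ if $x=y$ and $\max\{x,y\}$ otherwise. A Lipschitz $\mathcal L_d$-structure $\mathcal M$ is a nonempty set $M$ such that the interpretation $d^{\mathcal M}$ of $d$ is a pseudo-ultrametric on $M$, together with, for every $n$-ary predicate symbol $P$, a 1-Lipschitz map $P^{\mathcal M}:(M^n,d^{\mathcal M})\to(V,d_{max})$,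 for every $n$-ary function symbol $f$ a 1-Lipschitz map $f^{\mathcal M}:M^n\to M$, and for each constant an element of $M$; on $M^n$, $d^{\mathcal M}(\bar a,\bar b)=\max_i d^{\mathcal M}(a_i,b_i)$. A theory (set of sentences) $T$ is Lipschitz-satisfiable if some Lipschitz structure models every sentence of $T$, and finitely Lipschitz-satisfiable if every finite subset of $T$ is Lipschitz-satisfiable. *)

theory Defs
  imports "HOL-Analysis.Analysis"
begin

section \<open>Goedel sets\<close>

definition goedel_set :: "real set \<Rightarrow> bool" where
  "goedel_set V \<longleftrightarrow> V \<subseteq> {0..1} \<and> closed V \<and> 0 \<in> V \<and> 1 \<in> V"

text \<open>The topology generated by the open rays of the linear order restricted to \<open>V\<close>.
  For \<open>V\<close> with at least two elements (in particular for Goedel sets) the rays cover \<open>V\<close>.\<close>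

definition order_topology_on :: "real set \<Rightarrow> real topology" where
  "order_topology_on V =
     topology_generated_by ((\<lambda>a. {x \<in> V. a < x}) ` V \<union> (\<lambda>a. {x \<in> V. x < a}) ` V)"

definition limit_points :: "real set \<Rightarrow> real set" where
  "limit_points V = (order_topology_on V) derived_set_of V"

lemma topspace_order_topology_on:
  assumes "goedel_set V"
  shows "topspace (order_topology_on V) = V"
proof -
  have 01: "0 \<in> V" "1 \<in> V"
    using assms by (auto simp: goedel_set_def)
  have "x \<in> \<Union> ((\<lambda>a. {x \<in> V. a < x}) ` V \<union> (\<lambda>a. {x \<in> V. x < a}) ` V)" if "x \<in> V" for x
  proof (cases "0 < x")
    case True
    then show ?thesis using that 01 by blast
  next
    case False
    then have "x < 1" by simp
    then show ?thesis using that 01 by blast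
  qed
  then show ?thesis
    unfolding order_topology_on_def topology_generated_by_topspace by blast
qed

text \<open>For Goedel sets the order topology is the Euclidean subspace topology.\<close>

lemma order_topology_on_eq_subspace:
  assumes "goedel_set V"
  shows "order_topology_on V = top_of_set V"
proof -
  let ?B = "(\<lambda>a. {x \<in> V. a < x}) ` V \<union> (\<lambda>a. {x \<in> V. x < a}) ` V"
  have top: "topspace (order_topology_on V) = V"
    by (rule topspace_order_topology_on[OF assms])
  have ray: "openin (order_topology_on V) {x \<in> V. a < x}"
            "openin (order_topology_on V) {x \<in> V. x < a}" if "a \<in> V" for a
    unfolding order_topology_on_def using that by (auto intro!: topology_generated_by_Basis)
  have cont: "continuous_map (top_of_set V) (order_topology_on V) id"
    unfolding order_topology_on_def
  proof (rule continuous_on_generated_topo)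
    fix U assume "U \<in> ?B"
    then obtain W where "open W" "U = V \<inter> W"
      by (auto simp: greaterThan_def[symmetric] lessThan_def[symmetric] Collect_conj_eq
               intro: open_greaterThan open_lessThan)
    then show "openin (top_of_set V) (id -` U \<inter> topspace (top_of_set V))"
      by (auto simp: openin_open)
  next
    show "id ` topspace (top_of_set V) \<subseteq> \<Union> ?B"
      using top by (simp add: order_topology_on_def)
  qed
  have haus: "Hausdorff_space (order_topology_on V)"
  proof -
    have sep: "\<exists>U W. openin (order_topology_on V) U \<and> openin (order_topology_on V) W \<and>
                 x \<in> U \<and> y \<in> W \<and> disjnt U W" if "x \<in> V" "y \<in> V" "x < y" for x y
    proof (cases "\<exists>z\<in>V. x < z \<and> z < y")
      case True
      then obtain z where z: "z \<in> V" "x < z" "z < y" by blast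
      show ?thesis
        by (rule exI[of _ "{u \<in> V. u < z}"], rule exI[of _ "{u \<in> V. z < u}"])
           (use that z ray in \<open>auto simp: disjnt_def\<close>)
    next
      case False
      show ?thesis
        by (rule exI[of _ "{u \<in> V. u < y}"], rule exI[of _ "{u \<in> V. x < u}"])
           (use that False ray in \<open>auto simp: disjnt_def\<close>)
    qed
    show ?thesis
      unfolding Hausdorff_space_def top
      by (metis disjnt_sym linorder_neqE sep)
  qed
  have "compact V"
    using assms compact_Icc[of 0 "1::real"] closed_Int_compact[of V "{0..1}"]
    by (auto simp: goedel_set_def Int_absorb2)
  then have "homeomorphic_map (top_of_set V) (order_topology_on V) id"
    using cont haus top
    by (intro continuous_imp_homeomorphic_map) (auto simp: compact_space_subtopology)
  then show ?thesis
    by (simp add: homeomorphic_map_id)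
qed

corollary limit_points_eq_islimpt:
  assumes "goedel_set V"
  shows "limit_points V = {x. x islimpt V}"
proof -
  have "x \<in> V" if "x islimpt V" for x
    using that assms by (auto simp: goedel_set_def closed_limpt)
  then show ?thesis
    unfolding limit_points_def order_topology_on_eq_subspace[OF assms]
    by (auto simp: derived_set_of_subtopology in_derived_set_of islimpt_def; blast)
qed

definition d_max :: "real \<Rightarrow> real \<Rightarrow> real" where
  "d_max x y = (if x = y then 0 else max x y)"


section \<open>Syntax\<close>

text \<open>The component \<open>dsym\<close> is the distinguished symbol \<open>d\<close>. Symbols are drawn from arbitrary types, so languages of any cardinality (also with no
  function symbols) are covered. Constants are the function symbols of arity \<open>0\<close>.\<close>

record ('f, 'p) lang =
  funs :: "'f set"
  preds :: "'p set"
  fun_arity :: "'f \<Rightarrow> nat"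
  pred_arity :: "'p \<Rightarrow> nat"
  dsym :: 'p

definition is_language_d :: "('f, 'p) lang \<Rightarrow> bool" where
  "is_language_d L \<longleftrightarrow> dsym L \<in> preds L \<and> pred_arity L (dsym L) = 2"

datatype 'f tm = Var nat | Fun 'f "'f tm list"

text \<open>\<open>Truth r\<close> is the nullary connective for the truth value \<open>r\<close>.\<close>

datatype ('f, 'p) fm =
    Atom 'p "'f tm list"
  | Bot
  | Truth real
  | And "('f, 'p) fm" "('f, 'p) fm"
  | Imp "('f, 'p) fm" "('f, 'p) fm"
  | All nat "('f, 'p) fm"
  | Ex nat "('f, 'p) fm"

fun wf_tm :: "('f, 'p) lang \<Rightarrow> 'f tm \<Rightarrow> bool" where
  "wf_tm L (Var x) \<longleftrightarrow> True"
| "wf_tm L (Fun f ts) \<longleftrightarrow>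
     f \<in> funs L \<and> length ts = fun_arity L f \<and> (\<forall>t\<in>set ts. wf_tm L t)"

text \<open>Formulas of the logic over \<open>L\<close> with nullary connectives for the elements of \<open>A\<close>.\<close>

primrec wf_fm :: "('f, 'p) lang \<Rightarrow> real set \<Rightarrow> ('f, 'p) fm \<Rightarrow> bool" where
  "wf_fm L A (Atom P ts) \<longleftrightarrow>
     P \<in> preds L \<and> length ts = pred_arity L P \<and> (\<forall>t\<in>set ts. wf_tm L t)"
| "wf_fm L A Bot \<longleftrightarrow> True"
| "wf_fm L A (Truth r) \<longleftrightarrow> r \<in> A"
| "wf_fm L A (And \<phi> \<psi>) \<longleftrightarrow> wf_fm L A \<phi> \<and> wf_fm L A \<psi>"
| "wf_fm L A (Imp \<phi> \<psi>) \<longleftrightarrow> wf_fm L A \<phi> \<and> wf_fm L A \<psi>"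
| "wf_fm L A (All x \<phi>) \<longleftrightarrow> wf_fm L A \<phi>"
| "wf_fm L A (Ex x \<phi>) \<longleftrightarrow> wf_fm L A \<phi>"

fun vars_tm :: "'f tm \<Rightarrow> nat set" where
  "vars_tm (Var x) = {x}"
| "vars_tm (Fun f ts) = (\<Union>t\<in>set ts. vars_tm t)"

primrec free_vars :: "('f, 'p) fm \<Rightarrow> nat set" where
  "free_vars (Atom P ts) = (\<Union>t\<in>set ts. vars_tm t)"
| "free_vars Bot = {}"
| "free_vars (Truth r) = {}"
| "free_vars (And \<phi> \<psi>) = free_vars \<phi> \<union> free_vars \<psi>"
| "free_vars (Imp \<phi> \<psi>) = free_vars \<phi> \<union> free_vars \<psi>"
| "free_vars (All x \<phi>) = free_vars \<phi> - {x}"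
| "free_vars (Ex x \<phi>) = free_vars \<phi> - {x}"

definition is_sentence :: "('f, 'p) lang \<Rightarrow> real set \<Rightarrow> ('f, 'p) fm \<Rightarrow> bool" where
  "is_sentence L A \<phi> \<longleftrightarrow> wf_fm L A \<phi> \<and> free_vars \<phi> = {}"

definition is_theory :: "('f, 'p) lang \<Rightarrow> real set \<Rightarrow> ('f, 'p) fm set \<Rightarrow> bool" where
  "is_theory L A T \<longleftrightarrow> (\<forall>\<phi>\<in>T. is_sentence L A \<phi>)"


section \<open>Reversed semantics: \<open>0\<close> is absolute truth, \<open>1\<close> is absolute falsity\<close>

record ('f, 'p, 'm) struct =
  univ :: "'m set"
  fun_int :: "'f \<Rightarrow> 'm list \<Rightarrow> 'm"
  pred_int :: "'p \<Rightarrow> 'm list \<Rightarrow> real"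

primrec eval_tm :: "('f, 'p, 'm) struct \<Rightarrow> (nat \<Rightarrow> 'm) \<Rightarrow> 'f tm \<Rightarrow> 'm" where
  "eval_tm M s (Var x) = s x"
| "eval_tm M s (Fun f ts) = fun_int M f (map (eval_tm M s) ts)"

text \<open>A closed \<open>V\<close> contains the real suprema and infima of its nonempty bounded subsets, so these
  are also the suprema and infima in \<open>V\<close>.\<close>

primrec eval :: "('f, 'p, 'm) struct \<Rightarrow> (nat \<Rightarrow> 'm) \<Rightarrow> ('f, 'p) fm \<Rightarrow> real" where
  "eval M s (Atom P ts) = pred_int M P (map (eval_tm M s) ts)"
| "eval M s Bot = 1"
| "eval M s (Truth r) = r"
| "eval M s (And \<phi> \<psi>) = max (eval M s \<phi>) (eval M s \<psi>)"
| "eval M s (Imp \<phi> \<psi>) = (if eval M s \<phi> \<ge> eval M s \<psi> then 0 else eval M s \<psi>)"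
| "eval M s (All x \<phi>) = (SUP a\<in>univ M. eval M (s(x := a)) \<phi>)"
| "eval M s (Ex x \<phi>) = (INF a\<in>univ M. eval M (s(x := a)) \<phi>)"

text \<open>Only used for sentences, whose value does not depend on the assignment \<open>s\<close>.\<close>

definition models :: "('f, 'p, 'm) struct \<Rightarrow> ('f, 'p) fm \<Rightarrow> bool" where
  "models M \<phi> \<longleftrightarrow> (\<forall>s. range s \<subseteq> univ M \<longrightarrow> eval M s \<phi> = 0)"


section \<open>Lipschitz structures\<close>

definition tuples :: "'m set \<Rightarrow> nat \<Rightarrow> 'm list set" where
  "tuples X n = {as. length as = n \<and> set as \<subseteq> X}"

text \<open>The maximum metric on tuples; the additional \<open>0\<close> only matters for tuples of length \<open>0\<close>.\<close>

definition tuple_dist :: "('m \<Rightarrow> 'm \<Rightarrow> real) \<Rightarrow> 'm list \<Rightarrow> 'm list \<Rightarrow> real" where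
  "tuple_dist \<delta> as bs = Max (insert 0 {\<delta> (as ! i) (bs ! i) | i. i < length as})"

definition one_lipschitz ::
    "'a set \<Rightarrow> ('a \<Rightarrow> 'a \<Rightarrow> real) \<Rightarrow> ('b \<Rightarrow> 'b \<Rightarrow> real) \<Rightarrow> ('a \<Rightarrow> 'b) \<Rightarrow> bool" where
  "one_lipschitz X \<delta> \<delta>' f \<longleftrightarrow> (\<forall>a\<in>X. \<forall>b\<in>X. \<delta>' (f a) (f b) \<le> \<delta> a b)"

definition pseudo_ultrametric :: "'m set \<Rightarrow> ('m \<Rightarrow> 'm \<Rightarrow> real) \<Rightarrow> bool" where
  "pseudo_ultrametric X \<delta> \<longleftrightarrow>
     (\<forall>a\<in>X. \<forall>b\<in>X. \<delta> a b \<ge> 0) \<and>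
     (\<forall>a\<in>X. \<delta> a a = 0) \<and>
     (\<forall>a\<in>X. \<forall>b\<in>X. \<delta> a b = \<delta> b a) \<and>
     (\<forall>a\<in>X. \<forall>b\<in>X. \<forall>c\<in>X. \<delta> a c \<le> max (\<delta> a b) (\<delta> b c))"

definition dist_int :: "('f, 'p) lang \<Rightarrow> ('f, 'p, 'm) struct \<Rightarrow> 'm \<Rightarrow> 'm \<Rightarrow> real" where
  "dist_int L M a b = pred_int M (dsym L) [a, b]"

definition lipschitz_structure ::
    "real set \<Rightarrow> ('f, 'p) lang \<Rightarrow> ('f, 'p, 'm) struct \<Rightarrow> bool" where
  "lipschitz_structure V L M \<longleftrightarrow>
     univ M \<noteq> {} \<and>
     pseudo_ultrametric (univ M) (dist_int L M) \<and>
     (\<forall>P\<in>preds L.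
        pred_int M P ` tuples (univ M) (pred_arity L P) \<subseteq> V \<and>
        one_lipschitz (tuples (univ M) (pred_arity L P))
          (tuple_dist (dist_int L M)) d_max (pred_int M P)) \<and>
     (\<forall>f\<in>funs L.
        fun_int M f ` tuples (univ M) (fun_arity L f) \<subseteq> univ M \<and>
        one_lipschitz (tuples (univ M) (fun_arity L f))
          (tuple_dist (dist_int L M)) (dist_int L M) (fun_int M f))"

text \<open>HOL cannot quantify existentially over types, so satisfiability is relative to a type
  \<open>'m\<close> whose subsets serve as universes. The type of formulas is infinite and at least as large
  as the language, so by the downward Loewenheim-Skolem theorem every Lipschitz-satisfiable
  theory already has a Lipschitz model with universe contained in that type.\<close>

definition lipschitz_satisfiable ::
    "'m itself \<Rightarrow> real set \<Rightarrow> ('f, 'p) lang \<Rightarrow> ('f, 'p) fm set \<Rightarrow> bool" where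
  "lipschitz_satisfiable TYPE('m) V L T \<longleftrightarrow>
     (\<exists>M :: ('f, 'p, 'm) struct. lipschitz_structure V L M \<and> (\<forall>\<phi>\<in>T. models M \<phi>))"

definition finitely_lipschitz_satisfiable ::
    "'m itself \<Rightarrow> real set \<Rightarrow> ('f, 'p) lang \<Rightarrow> ('f, 'p) fm set \<Rightarrow> bool" where
  "finitely_lipschitz_satisfiable TYPE('m) V L T \<longleftrightarrow>
     (\<forall>S. S \<subseteq> T \<and> finite S \<longrightarrow> lipschitz_satisfiable TYPE('m) V L S)"

end

theory Submission
  imports Defs
begin

text \<open>Models of the finite subsets of the theory are combined in an ultraproduct whose atomic
  truth values are ultralimits in the compact set \<open>V\<close>. A positive ultralimit is isolated in \<open>V\<close>
  and hence attained almost everywhere. This makes the discontinuous implication commute with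
  ultralimits, because its jumps occur only at pairs whose second component is positive. It also
  makes every supremum over a nonempty subset of \<open>V\<close> a maximum. Hence every formula takes in the
  ultraproduct the ultralimit of its values in the factors. A countable family of
  Skolem functions for each quantified formula then cuts the ultraproduct down to the
  size of the set of formulas.\<close>

section \<open>Ultrafilters\<close>

definition ultrafilter :: "'a filter \<Rightarrow> bool" where
  "ultrafilter F \<longleftrightarrow> F \<noteq> bot \<and> (\<forall>P. eventually P F \<or> eventually (\<lambda>x. \<not> P x) F)"

text \<open>Zorn's lemma on the proper filters below \<open>F\<close>. A finer filter is smaller in
  the order on filters, so the relation is reversed: its maximal elements are the minimal proper
  filters.\<close>

lemma ultrafilter_exists:
  fixes F :: "'a filter"
  assumes "F \<noteq> bot"
  shows "\<exists>U. ultrafilter U \<and> U \<le> F"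
proof -
  let ?A = "{G. G \<noteq> bot \<and> G \<le> F}"
  let ?r = "{(G, H). G \<in> ?A \<and> H \<in> ?A \<and> H \<le> G}"
  have field: "Field ?r = ?A"
    by (auto simp: Field_def)
  have po: "Partial_order ?r"
    unfolding partial_order_on_def preorder_on_def field
    by (auto simp: refl_on_def trans_def antisym_def)
  have "\<exists>U\<in>Field ?r. \<forall>G\<in>C. (G, U) \<in> ?r" if C: "C \<in> Chains ?r" for C
  proof (cases "C = {}")
    case True
    then show ?thesis using assms field by auto
  next
    case False
    have sub: "C \<subseteq> ?A"
      using C by (fastforce simp: Chains_def)
    \<comment> \<open>A chain is directed downwards, so whatever holds eventually along
      \<open>Inf C\<close> already does so along a single member; for \<open>False\<close> this
      contradicts properness of that member.\<close>
    have "Inf C \<noteq> bot"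
    proof
      assume "Inf C = bot"
      then have "eventually (\<lambda>_. False) (Inf C)" by simp
      moreover have "\<exists>x\<in>C. x \<le> inf G H" if "G \<in> C" "H \<in> C" for G H
      proof -
        have "G \<le> H \<or> H \<le> G" using C that by (auto simp: Chains_def)
        then show ?thesis using that by (metis inf.absorb1 inf.absorb2 order_refl)
      qed
      ultimately obtain G where "G \<in> C" "eventually (\<lambda>_. False) G"
        by (subst (asm) eventually_Inf_base) (use False in auto)
      then show False using sub by (auto simp: trivial_limit_def)
    qed
    moreover have "Inf C \<le> F"
      using False sub by (metis (no_types, lifting) Inf_lower2 ex_in_conv mem_Collect_eq subsetD)
    ultimately show ?thesis
      using sub unfolding field by (intro bexI[of _ "Inf C"]) (auto intro: Inf_lower)
  qed
  from Zorns_po_lemma[OF po this] obtain U where U: "U \<in> ?A"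
    and max: "\<And>G. G \<in> ?A \<Longrightarrow> G \<le> U \<Longrightarrow> G = U"
    unfolding field by auto
  \<comment> \<open>If adding \<open>P\<close> to \<open>U\<close> leaves the filter proper,
    minimality shows that \<open>P\<close> was already there; otherwise its negation is.\<close>
  have "eventually P U \<or> eventually (\<lambda>x. \<not> P x) U" for P
  proof (cases "inf U (principal {x. P x}) = bot")
    case True
    then show ?thesis
      by (auto simp: trivial_limit_def eventually_inf_principal elim: eventually_mono)
  next
    case False
    then have "inf U (principal {x. P x}) = U"
      using U by (intro max) (auto intro: le_infI1)
    moreover have "eventually P (inf U (principal {x. P x}))"
      by (simp add: eventually_inf_principal)
    ultimately have "eventually P U" by simp
    then show ?thesis ..
  qed
  then show ?thesis using U by (auto simp: ultrafilter_def)
qed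

text \<open>Compactness gives the image filter a cluster point. Along an ultrafilter this is a
  limit: if the values were not eventually in some neighbourhood of it, they would eventually lie
  outside.\<close>

lemma ultrafilter_tendsto_Lim:
  fixes f :: "'a \<Rightarrow> 'b::t2_space"
  assumes U: "ultrafilter U" and K: "compact K" and f: "\<And>x. f x \<in> K"
  shows "(f \<longlongrightarrow> Lim U f) U" "Lim U f \<in> K"
proof -
  have nb: "U \<noteq> bot" using U by (simp add: ultrafilter_def)
  then have "filtermap f U \<noteq> bot" by (simp add: filtermap_bot_iff)
  then obtain l where l: "l \<in> K" "inf (nhds l) (filtermap f U) \<noteq> bot"
    using K f unfolding compact_filter by (auto simp: eventually_filtermap)
  have lim: "(f \<longlongrightarrow> l) U"
  proof (rule topological_tendstoI, rule ccontr)
    fix S assume S: "open S" "l \<in> S" "\<not> eventually (\<lambda>x. f x \<in> S) U"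
    then have "eventually (\<lambda>x. f x \<notin> S) U"
      using U by (auto simp: ultrafilter_def)
    then have "eventually (\<lambda>y. y \<notin> S) (filtermap f U)"
      by (simp add: eventually_filtermap)
    moreover have "eventually (\<lambda>y. y \<in> S) (nhds l)"
      using S by (auto simp: eventually_nhds)
    ultimately have "eventually (\<lambda>_. False) (inf (nhds l) (filtermap f U))"
      unfolding eventually_inf by blast
    with l show False by (simp add: trivial_limit_def)
  qed
  then have "Lim U f = l" using nb by (rule tendsto_Lim[rotated])
  with lim l show "(f \<longlongrightarrow> Lim U f) U" "Lim U f \<in> K" by auto
qed


section \<open>Truth values accumulating at most at 0\<close>

lemma goedel_set_compact: "goedel_set V \<Longrightarrow> compact V"
  unfolding goedel_set_def by (metis compact_Icc closed_Int_compact Int_absorb2)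

lemma goedel_set_bdd:
  assumes "goedel_set V" "X \<subseteq> V"
  shows "bdd_above X" "bdd_below X"
  using assms unfolding goedel_set_def
  by (meson bdd_above_Icc bdd_below_Icc bdd_above_mono bdd_below_mono order_trans)+

lemma goedel_set_Sup_Inf_in:
  assumes "goedel_set V" "X \<subseteq> V" "X \<noteq> {}"
  shows "Sup X \<in> V" "Inf X \<in> V"
  using assms goedel_set_bdd[OF assms(1,2)] unfolding goedel_set_def
  by (auto intro: closed_subset_contains_Sup closed_subset_contains_Inf)

text \<open>A supremum outside \<open>X\<close> would be a limit point of \<open>V\<close>, hence 0.
  But then the nonnegative set \<open>X\<close> is {0}, which contains its supremum.\<close>

lemma Sup_attained:
  assumes V: "goedel_set V" "limit_points V \<subseteq> {0}" and X: "X \<subseteq> V" "X \<noteq> {}"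
  shows "Sup X \<in> X"
proof (rule ccontr)
  assume n: "Sup X \<notin> X"
  have bdd: "bdd_above X" by (rule goedel_set_bdd(1)[OF V(1) X(1)])
  have "Sup X \<in> closure X" by (rule closure_contains_Sup[OF X(2) bdd])
  then have "Sup X islimpt V"
    using n X(1) by (auto simp: closure_def intro: islimpt_subset)
  then have s0: "Sup X = 0" using V by (auto simp: limit_points_eq_islimpt)
  obtain x where x: "x \<in> X" using X by blast
  then have "x \<le> 0" "0 \<le> x"
    using cSup_upper[OF x bdd] s0 V X by (auto simp: goedel_set_def)
  with s0 n x show False by auto
qed

text \<open>A nonzero \<open>l\<close> is no limit point, so some neighbourhood of it contains no
  point of \<open>V\<close> other than possibly \<open>l\<close> itself.\<close>

lemma tendsto_isolated:
  assumes V: "goedel_set V" "limit_points V \<subseteq> {0}"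
    and f: "\<And>i. f i \<in> V" and lim: "(f \<longlongrightarrow> l) F" and l: "l \<noteq> 0"
  shows "eventually (\<lambda>i. f i = l) F"
proof -
  have "\<not> l islimpt V" using V l by (auto simp: limit_points_eq_islimpt)
  then obtain T where "l \<in> T" "open T" "\<forall>y\<in>V. y \<in> T \<longrightarrow> y = l"
    unfolding islimpt_def by blast
  with topological_tendstoD[OF lim, of T] f show ?thesis
    by (auto elim: eventually_mono)
qed

text \<open>The truth function of implication is discontinuous exactly where
  \<open>a = b > 0\<close>; there both families are eventually constant. At \<open>b = 0\<close> it
  is squeezed between 0 and \<open>g\<close>.\<close>

lemma tendsto_goedel_imp:
  assumes V: "goedel_set V" "limit_points V \<subseteq> {0}"
    and fV: "\<And>i. f i \<in> V" and gV: "\<And>i. g i \<in> V"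
    and f: "(f \<longlongrightarrow> a) F" and g: "(g \<longlongrightarrow> b) F"
    and a0: "0 \<le> a" and b0: "0 \<le> b"
  shows "((\<lambda>i. if f i \<ge> g i then 0 else g i) \<longlongrightarrow> (if a \<ge> b then 0 else b)) F"
proof -
  have pos: "0 \<le> f i" "0 \<le> g i" for i
    using fV[of i] gV[of i] V by (auto simp: goedel_set_def)
  consider "b = 0" | "b > 0" "a < b" | "b > 0" "a \<ge> b" using b0 by linarith
  then show ?thesis
  proof cases
    case 1
    have "((\<lambda>i. if f i \<ge> g i then 0 else g i) \<longlongrightarrow> 0) F"
      by (rule tendsto_sandwich[OF _ _ tendsto_const g[unfolded 1]]) (auto simp: pos)
    with 1 a0 show ?thesis by simp
  next
    case 2
    then have "eventually (\<lambda>i. g i = b) F"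
      using tendsto_isolated[OF V gV g] by simp
    moreover have "eventually (\<lambda>i. f i < b) F"
      using order_tendstoD(2)[OF f] 2 by simp
    ultimately have "eventually (\<lambda>i. (if f i \<ge> g i then 0 else g i) = b) F"
      by eventually_elim auto
    with 2 show ?thesis by (simp add: tendsto_eventually)
  next
    case 3
    then have "eventually (\<lambda>i. g i = b) F" "eventually (\<lambda>i. f i = a) F"
      using tendsto_isolated[OF V gV g] tendsto_isolated[OF V fV f] by simp_all
    then have "eventually (\<lambda>i. (if f i \<ge> g i then 0 else g i) = 0) F"
      by eventually_elim (use 3 in auto)
    with 3 show ?thesis by (simp add: tendsto_eventually)
  qed
qed


section \<open>Evaluation in Lipschitz structures\<close>

lemma finite_vars_tm: "finite (vars_tm t)"
  by (induction t) auto

lemma finite_free_vars: "finite (free_vars \<phi>)"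
  by (induction \<phi>) (auto simp: finite_vars_tm)

lemma eval_tm_cong: "(\<And>x. x \<in> vars_tm t \<Longrightarrow> s x = s' x) \<Longrightarrow> eval_tm M s t = eval_tm M s' t"
proof (induction t)
  case (Fun f ts)
  then have "map (eval_tm M s) ts = map (eval_tm M s') ts"
    by (intro map_cong refl Fun.IH) auto
  then show ?case by (simp only: eval_tm.simps)
qed simp

lemma eval_cong: "(\<And>x. x \<in> free_vars \<phi> \<Longrightarrow> s x = s' x) \<Longrightarrow> eval M s \<phi> = eval M s' \<phi>"
proof (induction \<phi> arbitrary: s s')
  case (Atom P ts)
  then have "map (eval_tm M s) ts = map (eval_tm M s') ts"
    by (intro map_cong refl eval_tm_cong) auto
  then show ?case by (simp only: eval.simps)
next
  case (And \<phi> \<psi>)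
  from And.IH[of s s'] And.prems show ?case by simp
next
  case (Imp \<phi> \<psi>)
  from Imp.IH[of s s'] Imp.prems show ?case by simp
next
  case (All x \<phi>)
  have "eval M (s(x := a)) \<phi> = eval M (s'(x := a)) \<phi>" for a
    by (rule All.IH) (use All.prems in auto)
  then show ?case by simp
next
  case (Ex x \<phi>)
  have "eval M (s(x := a)) \<phi> = eval M (s'(x := a)) \<phi>" for a
    by (rule Ex.IH) (use Ex.prems in auto)
  then show ?case by simp
qed simp_all

lemma lipschitz_structureD:
  assumes "lipschitz_structure V L M"
  shows "univ M \<noteq> {}"
    and "pseudo_ultrametric (univ M) (dist_int L M)"
    and "P \<in> preds L \<Longrightarrow> as \<in> tuples (univ M) (pred_arity L P) \<Longrightarrow> pred_int M P as \<in> V"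
    and "P \<in> preds L \<Longrightarrow> as \<in> tuples (univ M) (pred_arity L P) \<Longrightarrow>
      bs \<in> tuples (univ M) (pred_arity L P) \<Longrightarrow>
      d_max (pred_int M P as) (pred_int M P bs) \<le> tuple_dist (dist_int L M) as bs"
    and "f \<in> funs L \<Longrightarrow> as \<in> tuples (univ M) (fun_arity L f) \<Longrightarrow> fun_int M f as \<in> univ M"
    and "f \<in> funs L \<Longrightarrow> as \<in> tuples (univ M) (fun_arity L f) \<Longrightarrow>
      bs \<in> tuples (univ M) (fun_arity L f) \<Longrightarrow>
      dist_int L M (fun_int M f as) (fun_int M f bs) \<le> tuple_dist (dist_int L M) as bs"
  using assms unfolding lipschitz_structure_def one_lipschitz_def image_subset_iff by blast+

lemma eval_tm_in_univ:
  assumes "lipschitz_structure V L M" "range s \<subseteq> univ M" "wf_tm L t"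
  shows "eval_tm M s t \<in> univ M"
  using assms(3)
proof (induction t)
  case (Var x)
  then show ?case using assms by auto
next
  case (Fun f ts)
  then have "map (eval_tm M s) ts \<in> tuples (univ M) (fun_arity L f)"
    by (auto simp: tuples_def)
  with lipschitz_structureD(5)[OF assms(1)] Fun.prems show ?case by simp
qed

lemma map_eval_tm_in_tuples:
  assumes "lipschitz_structure V L M" "range s \<subseteq> univ M" "\<forall>t\<in>set ts. wf_tm L t" "length ts = n"
  shows "map (eval_tm M s) ts \<in> tuples (univ M) n"
  using assms eval_tm_in_univ[OF assms(1,2)] by (auto simp: tuples_def)

text \<open>Closedness of \<open>V\<close> covers the quantifiers, since the universe is nonempty,
  and \<open>A \<subseteq> V\<close> covers the nullary connectives.\<close>

lemma eval_in:
  assumes V: "goedel_set V" "A \<subseteq> V" and M: "lipschitz_structure V L M"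
  shows "range s \<subseteq> univ M \<Longrightarrow> wf_fm L A \<phi> \<Longrightarrow> eval M s \<phi> \<in> V"
proof (induction \<phi> arbitrary: s)
  case (Atom P ts)
  then have "map (eval_tm M s) ts \<in> tuples (univ M) (pred_arity L P)"
    using map_eval_tm_in_tuples[OF M] by simp
  then show ?case using lipschitz_structureD(3)[OF M] Atom by simp
next
  case (All x \<phi>)
  have ne: "univ M \<noteq> {}" using M by (simp add: lipschitz_structure_def)
  have "eval M (s(x := a)) \<phi> \<in> V" if "a \<in> univ M" for a
    by (rule All.IH) (use All.prems that in auto)
  then show ?case using ne by (auto intro!: goedel_set_Sup_Inf_in(1)[OF V(1)])
next
  case (Ex x \<phi>)
  have ne: "univ M \<noteq> {}" using M by (simp add: lipschitz_structure_def)
  have "eval M (s(x := a)) \<phi> \<in> V" if "a \<in> univ M" for a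
    by (rule Ex.IH) (use Ex.prems that in auto)
  then show ?case using ne by (auto intro!: goedel_set_Sup_Inf_in(2)[OF V(1)])
qed (use V in \<open>auto simp: goedel_set_def max_def\<close>)

section \<open>Recursion for the maximum distance on tuples\<close>

lemma tuple_dist_Nil: "tuple_dist \<delta> [] bs = 0"
  by (simp add: tuple_dist_def)

text \<open>Replaces a maximum over indices by a binary maximum, so that limits and images of tuple
  distances can be treated by induction on lists.\<close>

lemma tuple_dist_Cons:
  "tuple_dist \<delta> (a # as) (b # bs) = max (\<delta> a b) (tuple_dist \<delta> as bs)"
proof -
  have eq: "{\<delta> ((a # as) ! i) ((b # bs) ! i) |i. i < length (a # as)} =
      insert (\<delta> a b) {\<delta> (as ! i) (bs ! i) |i. i < length as}"
    unfolding setcompr_eq_image lessThan_def[symmetric] length_Cons lessThan_Suc_eq_insert_0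
    by (simp add: image_image)
  show ?thesis
    unfolding tuple_dist_def eq insert_commute[of 0] by (subst Max_insert) auto
qed

lemma tuple_dist_map:
  "length as = length bs \<Longrightarrow>
    tuple_dist \<delta> (map h as) (map h bs) = tuple_dist (\<lambda>a b. \<delta> (h a) (h b)) as bs"
  by (induction as bs rule: list_induct2) (simp_all add: tuple_dist_Nil tuple_dist_Cons)


section \<open>Ultraproducts\<close>

text \<open>There is no equality in the language, so the full product serves as universe and no
  quotient is needed.\<close>

definition ultraproduct ::
    "'i filter \<Rightarrow> ('i \<Rightarrow> ('f, 'p, 'm) struct) \<Rightarrow> ('f, 'p, 'i \<Rightarrow> 'm) struct" where
  "ultraproduct F M = \<lparr>
     univ = {a. \<forall>i. a i \<in> univ (M i)},
     fun_int = (\<lambda>f as i. fun_int (M i) f (map (\<lambda>a. a i) as)),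
     pred_int = (\<lambda>P as. Lim F (\<lambda>i. pred_int (M i) P (map (\<lambda>a. a i) as)))\<rparr>"

lemma eval_tm_ultraproduct:
  "eval_tm (ultraproduct F M) s t = (\<lambda>i. eval_tm (M i) (\<lambda>x. s x i) t)"
proof (induction t)
  case (Fun f ts)
  then have "map (\<lambda>a. a i) (map (eval_tm (ultraproduct F M) s) ts) =
      map (eval_tm (M i) (\<lambda>x. s x i)) ts" for i
    by auto
  then have "fun_int (ultraproduct F M) f (map (eval_tm (ultraproduct F M) s) ts) =
      (\<lambda>i. fun_int (M i) f (map (eval_tm (M i) (\<lambda>x. s x i)) ts))"
    by (simp only: ultraproduct_def struct.simps)
  then show ?case by simp
qed simp

lemma tuples_component:
  "as \<in> tuples (univ (ultraproduct F M)) n \<Longrightarrow> map (\<lambda>a. a i) as \<in> tuples (univ (M i)) n"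
  by (auto simp: tuples_def ultraproduct_def)

text \<open>The values in the factors lie in the compact set \<open>V\<close>, so the
  \<open>Lim\<close> in the definition of the ultraproduct is a genuine limit and not an arbitrary
  value.\<close>

lemma pred_int_ultraproduct:
  assumes F: "ultrafilter F" and V: "goedel_set V"
    and M: "\<And>i. lipschitz_structure V L (M i)"
    and P: "P \<in> preds L" "as \<in> tuples (univ (ultraproduct F M)) (pred_arity L P)"
  shows "((\<lambda>i. pred_int (M i) P (map (\<lambda>a. a i) as)) \<longlongrightarrow> pred_int (ultraproduct F M) P as) F"
    and "pred_int (ultraproduct F M) P as \<in> V"
proof -
  have "pred_int (M i) P (map (\<lambda>a. a i) as) \<in> V" for i
    by (rule lipschitz_structureD(3)[OF M P(1) tuples_component[OF P(2)]])
  from ultrafilter_tendsto_Lim[OF F goedel_set_compact[OF V] this]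
  show "((\<lambda>i. pred_int (M i) P (map (\<lambda>a. a i) as)) \<longlongrightarrow> pred_int (ultraproduct F M) P as) F"
    and "pred_int (ultraproduct F M) P as \<in> V"
    by (simp_all add: ultraproduct_def)
qed

text \<open>Functions act componentwise, and weak inequalities between distances survive
  ultralimits. Only the Lipschitz condition for predicates needs care, because \<open>d_max\<close>
  jumps on the diagonal.\<close>

lemma lipschitz_structure_ultraproduct:
  assumes L: "is_language_d L" and F: "ultrafilter F" and V: "goedel_set V"
    and M: "\<And>i. lipschitz_structure V L (M i)"
  shows "lipschitz_structure V L (ultraproduct F M)"
proof -
  let ?N = "ultraproduct F M"
  let ?d = "\<lambda>i. dist_int L (M i)"
  have nb: "F \<noteq> bot" using F by (simp add: ultrafilter_def)
  note pred = pred_int_ultraproduct[where M = M, OF F V M]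
  have U: "a i \<in> univ (M i)" if "a \<in> univ ?N" for a i
    using that by (simp add: ultraproduct_def)
  have ps: "pseudo_ultrametric (univ (M i)) (?d i)" for i
    using M[of i] by (simp add: lipschitz_structure_def)
  \<comment> \<open>The distance is itself the interpretation of a predicate symbol, so it is an
    ultralimit by construction.\<close>
  have dlim: "((\<lambda>i. ?d i (a i) (b i)) \<longlongrightarrow> dist_int L ?N a b) F"
    if "a \<in> univ ?N" "b \<in> univ ?N" for a b
    using pred(1)[of "dsym L" "[a, b]"] L that
    by (simp add: dist_int_def is_language_d_def tuples_def)
  have tlim: "((\<lambda>i. tuple_dist (?d i) (map (\<lambda>a. a i) as) (map (\<lambda>a. a i) bs))
      \<longlongrightarrow> tuple_dist (dist_int L ?N) as bs) F"
    if "as \<in> tuples (univ ?N) n" "bs \<in> tuples (univ ?N) n" for as bs n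
  proof -
    have "length as = length bs" "set as \<subseteq> univ ?N" "set bs \<subseteq> univ ?N"
      using that by (auto simp: tuples_def)
    then show ?thesis
      by (induction as bs rule: list_induct2)
        (auto simp: tuple_dist_Nil tuple_dist_Cons intro!: tendsto_max dlim)
  qed
  have "univ ?N \<noteq> {}"
  proof -
    have "\<forall>i. \<exists>a. a \<in> univ (M i)" using lipschitz_structureD(1)[OF M] by blast
    then obtain a where "\<forall>i. a i \<in> univ (M i)" by metis
    then show ?thesis by (auto simp: ultraproduct_def)
  qed
  moreover have "pseudo_ultrametric (univ ?N) (dist_int L ?N)"
    unfolding pseudo_ultrametric_def
  proof (intro conjI ballI)
    fix a b assume ab: "a \<in> univ ?N" "b \<in> univ ?N"
    show "0 \<le> dist_int L ?N a b"
      by (rule tendsto_lowerbound[OF dlim[OF ab] _ nb])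
        (use ps ab U in \<open>auto simp: pseudo_ultrametric_def\<close>)
    have "?d i (a i) (b i) = ?d i (b i) (a i)" for i
      using ps[of i] ab U by (auto simp: pseudo_ultrametric_def)
    then show "dist_int L ?N a b = dist_int L ?N b a"
      using tendsto_unique[OF nb dlim[OF ab(1,2)]] dlim[OF ab(2,1)] by simp
    fix c assume c: "c \<in> univ ?N"
    show "dist_int L ?N a c \<le> max (dist_int L ?N a b) (dist_int L ?N b c)"
      by (rule tendsto_le[OF nb tendsto_max[OF dlim[OF ab] dlim[OF ab(2) c]] dlim[OF ab(1) c]])
        (use ps ab c U in \<open>auto simp: pseudo_ultrametric_def\<close>)
  next
    fix a assume a: "a \<in> univ ?N"
    have "?d i (a i) (a i) = 0" for i
      using ps[of i] a U by (auto simp: pseudo_ultrametric_def)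
    then show "dist_int L ?N a a = 0"
      using dlim[OF a a] nb by (simp add: tendsto_const_iff)
  qed
  moreover have "d_max (pred_int ?N P as) (pred_int ?N P bs) \<le> tuple_dist (dist_int L ?N) as bs"
    if P: "P \<in> preds L" and as: "as \<in> tuples (univ ?N) (pred_arity L P)"
      and bs: "bs \<in> tuples (univ ?N) (pred_arity L P)" for P as bs
  proof (cases "pred_int ?N P as = pred_int ?N P bs")
    case True
    have "0 \<le> tuple_dist (dist_int L ?N) as bs"
      by (simp add: tuple_dist_def)
    with True show ?thesis by (simp add: d_max_def)
  next
    case False
    let ?x = "\<lambda>i. pred_int (M i) P (map (\<lambda>a. a i) as)"
    let ?y = "\<lambda>i. pred_int (M i) P (map (\<lambda>a. a i) bs)"
    \<comment> \<open>Distinct limits force distinct values almost everywhere, and off the diagonal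
      \<open>d_max\<close> is the continuous function \<open>max\<close>.\<close>
    have "eventually (\<lambda>i. ?x i - ?y i \<noteq> 0) F"
      by (rule tendsto_imp_eventually_ne[OF tendsto_diff[OF pred(1)[OF P as] pred(1)[OF P bs]]])
        (use False in simp)
    then have "eventually (\<lambda>i. max (?x i) (?y i) \<le>
        tuple_dist (?d i) (map (\<lambda>a. a i) as) (map (\<lambda>a. a i) bs)) F"
    proof eventually_elim
      case (elim i)
      have "d_max (?x i) (?y i) \<le> tuple_dist (?d i) (map (\<lambda>a. a i) as) (map (\<lambda>a. a i) bs)"
        by (rule lipschitz_structureD(4)[OF M P tuples_component[OF as] tuples_component[OF bs]])
      then show ?case using elim by (simp add: d_max_def)
    qed
    then have "max (pred_int ?N P as) (pred_int ?N P bs) \<le> tuple_dist (dist_int L ?N) as bs"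
      by (rule tendsto_le[OF nb tlim[OF as bs] tendsto_max[OF pred(1)[OF P as] pred(1)[OF P bs]]])
    then show ?thesis using False by (simp add: d_max_def)
  qed
  moreover have fun_in: "fun_int ?N f as \<in> univ ?N"
    if "f \<in> funs L" "as \<in> tuples (univ ?N) (fun_arity L f)" for f as
  proof -
    have "fun_int (M i) f (map (\<lambda>a. a i) as) \<in> univ (M i)" for i
      by (rule lipschitz_structureD(5)[OF M that(1) tuples_component[OF that(2)]])
    then show ?thesis by (simp add: ultraproduct_def)
  qed
  moreover have "dist_int L ?N (fun_int ?N f as) (fun_int ?N f bs)
      \<le> tuple_dist (dist_int L ?N) as bs"
    if f: "f \<in> funs L" and as: "as \<in> tuples (univ ?N) (fun_arity L f)"
      and bs: "bs \<in> tuples (univ ?N) (fun_arity L f)" for f as bs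
  proof (rule tendsto_le[OF nb tlim[OF as bs] dlim[OF fun_in[OF f as] fun_in[OF f bs]]])
    have "?d i (fun_int ?N f as i) (fun_int ?N f bs i)
        \<le> tuple_dist (?d i) (map (\<lambda>a. a i) as) (map (\<lambda>a. a i) bs)" for i
      using lipschitz_structureD(6)[OF M f tuples_component[OF as] tuples_component[OF bs], of i]
      by (simp add: ultraproduct_def)
    then show "eventually (\<lambda>i. ?d i (fun_int ?N f as i) (fun_int ?N f bs i)
        \<le> tuple_dist (?d i) (map (\<lambda>a. a i) as) (map (\<lambda>a. a i) bs)) F" by simp
  qed
  ultimately show ?thesis
    using pred(2) unfolding lipschitz_structure_def one_lipschitz_def image_subset_iff by blast
qed

text \<open>The analogue of the theorem of Los for real truth values. Connectives commute with
  ultralimits by continuity of \<open>max\<close> and by \<open>tendsto_goedel_imp\<close>;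
  quantifiers are handled by choosing elements in all factors at once.\<close>

lemma los:
  assumes L: "is_language_d L" and F: "ultrafilter F"
    and V: "goedel_set V" "limit_points V \<subseteq> {0}" and A: "A \<subseteq> V"
    and M: "\<And>i. lipschitz_structure V L (M i)"
  shows "range s \<subseteq> univ (ultraproduct F M) \<Longrightarrow> wf_fm L A \<phi> \<Longrightarrow>
    ((\<lambda>i. eval (M i) (\<lambda>x. s x i) \<phi>) \<longlongrightarrow> eval (ultraproduct F M) s \<phi>) F"
proof (induction \<phi> arbitrary: s)
  case (Atom P ts)
  let ?N = "ultraproduct F M"
  have "map (eval_tm ?N s) ts \<in> tuples (univ ?N) (pred_arity L P)"
    using map_eval_tm_in_tuples[OF lipschitz_structure_ultraproduct[OF L F V(1) M]] Atom by simp
  from pred_int_ultraproduct(1)[OF F V(1) M _ this] Atom.prems show ?case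
    by (simp add: eval_tm_ultraproduct comp_def)
next
  case (And \<phi> \<psi>)
  then show ?case by (auto intro!: tendsto_max)
next
  case (Imp \<phi> \<psi>)
  let ?N = "ultraproduct F M"
  have r: "range (\<lambda>x. s x i) \<subseteq> univ (M i)" for i
    using Imp.prems by (auto simp: ultraproduct_def)
  have wf: "wf_fm L A \<phi>" "wf_fm L A \<psi>" using Imp.prems by auto
  have "eval ?N s \<phi> \<in> V" "eval ?N s \<psi> \<in> V"
    using eval_in[OF V(1) A lipschitz_structure_ultraproduct[OF L F V(1) M] Imp.prems(1)] wf by auto
  then have nn: "0 \<le> eval ?N s \<phi>" "0 \<le> eval ?N s \<psi>"
    using V by (auto simp: goedel_set_def)
  show ?case unfolding eval.simps
    by (rule tendsto_goedel_imp[OF V eval_in[OF V(1) A M r wf(1)] eval_in[OF V(1) A M r wf(2)]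
          Imp.IH(1)[OF Imp.prems(1) wf(1)] Imp.IH(2)[OF Imp.prems(1) wf(2)] nn])
next
  case (All x \<phi>)
  let ?N = "ultraproduct F M"
  let ?g = "\<lambda>i b. eval (M i) ((\<lambda>y. s y i)(x := b)) \<phi>"
  have nb: "F \<noteq> bot" using F by (simp add: ultrafilter_def)
  have wf: "wf_fm L A \<phi>" using All.prems by simp
  have rN: "range (s(x := a)) \<subseteq> univ ?N" if "a \<in> univ ?N" for a
    using that All.prems by auto
  have gV: "?g i ` univ (M i) \<subseteq> V" for i
  proof
    fix v assume "v \<in> ?g i ` univ (M i)"
    then obtain b where b: "b \<in> univ (M i)" "v = ?g i b" by blast
    show "v \<in> V" unfolding b(2)
      by (rule eval_in[OF V(1) A M _ wf]) (use All.prems b in \<open>auto simp: ultraproduct_def\<close>)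
  qed
  have ne: "?g i ` univ (M i) \<noteq> {}" for i
    using M[of i] by (simp add: lipschitz_structure_def)
  have upd: "(\<lambda>y. (s(x := a)) y i) = (\<lambda>y. s y i)(x := a i)" for a i by auto
  have IH: "((\<lambda>i. ?g i (a i)) \<longlongrightarrow> eval ?N (s(x := a)) \<phi>) F" if "a \<in> univ ?N" for a
    using All.IH[OF rN[OF that] wf] by (simp only: upd)
  \<comment> \<open>Maximizers in the factors together form one element \<open>a\<close> of the
    ultraproduct. Approximate ones with a fixed error would only give the supremum up to that
    error.\<close>
  have "\<exists>b. b \<in> univ (M i) \<and> ?g i b = Sup (?g i ` univ (M i))" for i
    using Sup_attained[OF V gV[of i] ne[of i]] by force
  then obtain a where a: "\<And>i. a i \<in> univ (M i)" "\<And>i. ?g i (a i) = Sup (?g i ` univ (M i))"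
    by metis
  have aN: "a \<in> univ ?N" using a(1) by (simp add: ultraproduct_def)
  have "(SUP c\<in>univ ?N. eval ?N (s(x := c)) \<phi>) = eval ?N (s(x := a)) \<phi>"
  proof (rule cSup_eq_maximum)
    show "eval ?N (s(x := a)) \<phi> \<in> (\<lambda>c. eval ?N (s(x := c)) \<phi>) ` univ ?N"
      using aN by blast
    fix v assume "v \<in> (\<lambda>c. eval ?N (s(x := c)) \<phi>) ` univ ?N"
    then obtain c where c: "c \<in> univ ?N" "v = eval ?N (s(x := c)) \<phi>" by blast
    have "?g i (c i) \<le> ?g i (a i)" for i
      unfolding a(2) using c(1) goedel_set_bdd(1)[OF V(1) gV]
      by (intro cSUP_upper) (auto simp: ultraproduct_def)
    then show "v \<le> eval ?N (s(x := a)) \<phi>"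
      unfolding c(2) by (intro tendsto_le[OF nb IH[OF aN] IH[OF c(1)]]) simp
  qed
  then show ?case using IH[OF aN] a(2) by simp
next
  case (Ex x \<phi>)
  let ?N = "ultraproduct F M"
  let ?g = "\<lambda>i b. eval (M i) ((\<lambda>y. s y i)(x := b)) \<phi>"
  let ?m = "\<lambda>i. Inf (?g i ` univ (M i))"
  let ?h = "\<lambda>c. eval ?N (s(x := c)) \<phi>"
  have nb: "F \<noteq> bot" using F by (simp add: ultrafilter_def)
  have N: "lipschitz_structure V L ?N" by (rule lipschitz_structure_ultraproduct[OF L F V(1) M])
  have wf: "wf_fm L A \<phi>" using Ex.prems by simp
  have rN: "range (s(x := a)) \<subseteq> univ ?N" if "a \<in> univ ?N" for a
    using that Ex.prems by auto
  have gV: "?g i ` univ (M i) \<subseteq> V" for i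
  proof
    fix v assume "v \<in> ?g i ` univ (M i)"
    then obtain b where b: "b \<in> univ (M i)" "v = ?g i b" by blast
    show "v \<in> V" unfolding b(2)
      by (rule eval_in[OF V(1) A M _ wf]) (use Ex.prems b in \<open>auto simp: ultraproduct_def\<close>)
  qed
  have ne: "?g i ` univ (M i) \<noteq> {}" for i
    using M[of i] by (simp add: lipschitz_structure_def)
  have upd: "(\<lambda>y. (s(x := a)) y i) = (\<lambda>y. s y i)(x := a i)" for a i by auto
  have IH: "((\<lambda>i. ?g i (a i)) \<longlongrightarrow> ?h a) F" if "a \<in> univ ?N" for a
    using Ex.IH[OF rN[OF that] wf] by (simp only: upd)
  have hV: "?h ` univ ?N \<subseteq> V"
    using eval_in[OF V(1) A N rN wf] by blast
  have hne: "univ ?N \<noteq> {}" using N by (simp add: lipschitz_structure_def)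
  have mV: "?m i \<in> V" for i by (rule goedel_set_Sup_Inf_in(2)[OF V(1) gV ne])
  \<comment> \<open>The infima of the factors lie in \<open>V\<close> and so have an ultralimit
    \<open>l\<close>, the candidate for the infimum in the ultraproduct.\<close>
  from ultrafilter_tendsto_Lim(1)[where f = ?m, OF F goedel_set_compact[OF V(1)] mV]
  obtain l where l: "(?m \<longlongrightarrow> l) F" by blast
  have lower: "l \<le> ?h c" if c: "c \<in> univ ?N" for c
  proof (rule tendsto_le[OF nb IH[OF c] l])
    have "?m i \<le> ?g i (c i)" for i
      using c goedel_set_bdd(2)[OF V(1) gV]
      by (intro cINF_lower) (auto simp: ultraproduct_def)
    then show "\<forall>\<^sub>F i in F. ?m i \<le> ?g i (c i)" by simp
  qed
  \<comment> \<open>Infima need not be attained, neither in the factors nor in the ultraproduct.\<close>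
  have upper: "\<exists>c\<in>univ ?N. ?h c \<le> l + e" if e: "e > 0" for e
  proof -
    have "\<exists>b. b \<in> univ (M i) \<and> ?g i b < ?m i + e" for i
      using cInf_lessD[OF ne[of i], of "?m i + e"] e by auto
    then obtain c where c: "\<And>i. c i \<in> univ (M i)" "\<And>i. ?g i (c i) < ?m i + e"
      by metis
    have cN: "c \<in> univ ?N" using c(1) by (simp add: ultraproduct_def)
    have "?h c \<le> l + e"
      by (rule tendsto_le[OF nb tendsto_add[OF l tendsto_const] IH[OF cN]])
        (intro always_eventually allI less_imp_le c(2))
    with cN show ?thesis by blast
  qed
  have "(INF c\<in>univ ?N. ?h c) = l"
  proof (rule antisym)
    show "(INF c\<in>univ ?N. ?h c) \<le> l"
    proof (rule field_le_epsilon)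
      fix e :: real assume "e > 0"
      with upper obtain c where "c \<in> univ ?N" "?h c \<le> l + e" by blast
      then show "(INF c\<in>univ ?N. ?h c) \<le> l + e"
        using cINF_lower2[OF goedel_set_bdd(2)[OF V(1) hV]] by blast
    qed
  qed (use lower hne in \<open>auto intro: cINF_greatest\<close>)
  with l show ?case by simp
qed simp_all


section \<open>Elementary substructures of bounded size\<close>

text \<open>Formulas serve as codes of Skolem terms: \<open>And \<phi> \<psi>\<close> applies the Skolem function coded by
  \<open>\<phi>\<close> to the argument list coded by \<open>\<psi>\<close>, and \<open>Imp\<close> is the list constructor. The Skolem function
  \<open>Ex n (All x \<phi>)\<close> picks an \<open>x\<close> for which the value of \<open>\<phi>\<close> lies in the \<open>n\<close>-th rational interval.\<close>

definition list_assignment :: "'m \<Rightarrow> 'm list \<Rightarrow> nat \<Rightarrow> 'm" where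
  "list_assignment d xs i = (if i < length xs then xs ! i else d)"

text \<open>The index must be a natural number because it occupies the bound-variable position of
  \<open>Ex\<close> in a code. Pairs with \<open>p \<ge> q\<close> give the empty interval.\<close>

definition rat_interval :: "nat \<Rightarrow> real set" where
  "rat_interval n = (let (p, q) = (from_nat n :: rat \<times> rat) in {of_rat p <..< of_rat q})"

text \<open>\<open>Atom P [Fun f ts]\<close> carries the function symbol \<open>f\<close>, which
  makes the coded elements closed under the functions of the language. The result may lie outside
  the universe, when arities do not match or no witness exists; \<open>decode\<close> repairs
  this.\<close>

fun skolem :: "('f, 'p, 'm) struct \<Rightarrow> 'm \<Rightarrow> ('f, 'p) fm \<Rightarrow> 'm list \<Rightarrow> 'm" where
  "skolem N d (Atom P [Fun f ts]) xs = fun_int N f xs"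
| "skolem N d (Ex n (All x \<phi>)) xs =
     (SOME b. b \<in> univ N \<and> eval N ((list_assignment d xs)(x := b)) \<phi> \<in> rat_interval n)"
| "skolem N d _ xs = d"

text \<open>Every formula is read both as an element and as an argument list, hence the pair. The
  fallback \<open>d\<close> keeps the first component in the universe for every code, provided
  \<open>d\<close> is there.\<close>

primrec decode :: "('f, 'p, 'm) struct \<Rightarrow> 'm \<Rightarrow> ('f, 'p) fm \<Rightarrow> 'm \<times> 'm list" where
  "decode N d (Atom P ts) = (d, [])"
| "decode N d Bot = (d, [])"
| "decode N d (Truth r) = (d, [])"
| "decode N d (And \<phi> \<psi>) =
     (let a = skolem N d \<phi> (snd (decode N d \<psi>)) in (if a \<in> univ N then a else d, []))"
| "decode N d (Imp \<phi> \<psi>) = (d, fst (decode N d \<phi>) # snd (decode N d \<psi>))"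
| "decode N d (All x \<phi>) = (d, [])"
| "decode N d (Ex x \<phi>) = (d, [])"

abbreviation decode_elem :: "('f, 'p, 'm) struct \<Rightarrow> 'm \<Rightarrow> ('f, 'p) fm \<Rightarrow> 'm" where
  "decode_elem N d c \<equiv> fst (decode N d c)"

primrec code_list :: "('f, 'p) fm list \<Rightarrow> ('f, 'p) fm" where
  "code_list [] = Bot"
| "code_list (c # cs) = Imp c (code_list cs)"

text \<open>The universe consists of codes, not of the elements coded: several codes may name one
  element and then have distance 0, which a pseudo-ultrametric permits.\<close>

definition skolem_hull :: "('f, 'p, 'm) struct \<Rightarrow> 'm \<Rightarrow> ('f, 'p, ('f, 'p) fm) struct" where
  "skolem_hull N d = \<lparr>
     univ = UNIV,
     fun_int = (\<lambda>f cs. And (Atom undefined [Fun f []]) (code_list cs)),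
     pred_int = (\<lambda>P cs. pred_int N P (map (decode_elem N d) cs))\<rparr>"

lemma decode_code_list: "snd (decode N d (code_list cs)) = map (decode_elem N d) cs"
  by (induction cs) auto

lemma decode_elem_in_univ: "d \<in> univ N \<Longrightarrow> decode_elem N d c \<in> univ N"
  by (cases c) (auto simp: Let_def)

lemma map_decode_elem_in_tuples:
  "d \<in> univ N \<Longrightarrow> cs \<in> tuples X n \<Longrightarrow> map (decode_elem N d) cs \<in> tuples (univ N) n"
  by (auto simp: tuples_def decode_elem_in_univ)

lemma decode_elem_fun_int:
  assumes N: "lipschitz_structure V L N" and d: "d \<in> univ N"
    and f: "f \<in> funs L" "length cs = fun_arity L f"
  shows "decode_elem N d (fun_int (skolem_hull N d) f cs) = fun_int N f (map (decode_elem N d) cs)"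
proof -
  have "map (decode_elem N d) cs \<in> tuples (univ N) (fun_arity L f)"
    using map_decode_elem_in_tuples[OF d, of cs UNIV] f by (auto simp: tuples_def)
  \<comment> \<open>Since the value lies in the universe, decoding does not fall back on
    \<open>d\<close>.\<close>
  then have "fun_int N f (map (decode_elem N d) cs) \<in> univ N"
    by (rule lipschitz_structureD(5)[OF N f(1)])
  then show ?thesis by (simp add: skolem_hull_def decode_code_list)
qed

lemma decode_elem_eval_tm:
  assumes N: "lipschitz_structure V L N" and d: "d \<in> univ N"
  shows "wf_tm L t \<Longrightarrow>
    decode_elem N d (eval_tm (skolem_hull N d) s t) = eval_tm N (\<lambda>y. decode_elem N d (s y)) t"
proof (induction t)
  case (Fun f ts)
  then have "map (decode_elem N d) (map (eval_tm (skolem_hull N d) s) ts)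
      = map (eval_tm N (\<lambda>y. decode_elem N d (s y))) ts"
    by auto
  moreover have "decode_elem N d (fun_int (skolem_hull N d) f (map (eval_tm (skolem_hull N d) s) ts))
      = fun_int N f (map (decode_elem N d) (map (eval_tm (skolem_hull N d) s) ts))"
    by (rule decode_elem_fun_int[OF N d]) (use Fun.prems in simp_all)
  ultimately show ?case by (simp only: eval_tm.simps)
qed simp

text \<open>Distances and predicates are pulled back along \<open>decode_elem N d\<close>, which
  commutes with the functions, so each condition is inherited from \<open>N\<close>.\<close>

lemma lipschitz_structure_skolem_hull:
  assumes N: "lipschitz_structure V L N" and d: "d \<in> univ N"
  shows "lipschitz_structure V L (skolem_hull N d)"
proof -
  let ?H = "skolem_hull N d" and ?h = "decode_elem N d"
  have dist: "dist_int L ?H = (\<lambda>a b. dist_int L N (?h a) (?h b))"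
    by (intro ext) (simp add: dist_int_def skolem_hull_def)
  have tdist: "tuple_dist (dist_int L ?H) as bs = tuple_dist (dist_int L N) (map ?h as) (map ?h bs)"
    if "as \<in> tuples X n" "bs \<in> tuples X n" for as bs X n
    unfolding dist using that by (subst tuple_dist_map) (auto simp: tuples_def)
  have "pseudo_ultrametric (univ ?H) (dist_int L ?H)"
    using lipschitz_structureD(2)[OF N] decode_elem_in_univ[OF d]
    unfolding pseudo_ultrametric_def dist by blast
  moreover have "pred_int ?H P as \<in> V"
    if "P \<in> preds L" "as \<in> tuples (univ ?H) (pred_arity L P)" for P as
    using lipschitz_structureD(3)[OF N that(1) map_decode_elem_in_tuples[OF d that(2)]]
    by (simp add: skolem_hull_def)
  moreover have "d_max (pred_int ?H P as) (pred_int ?H P bs) \<le> tuple_dist (dist_int L ?H) as bs"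
    if "P \<in> preds L" "as \<in> tuples (univ ?H) (pred_arity L P)"
      "bs \<in> tuples (univ ?H) (pred_arity L P)" for P as bs
    using lipschitz_structureD(4)[OF N that(1) map_decode_elem_in_tuples[OF d that(2)]
        map_decode_elem_in_tuples[OF d that(3)]]
    unfolding tdist[OF that(2,3)] by (simp add: skolem_hull_def)
  moreover have "dist_int L ?H (fun_int ?H f as) (fun_int ?H f bs)
      \<le> tuple_dist (dist_int L ?H) as bs"
    if "f \<in> funs L" "as \<in> tuples (univ ?H) (fun_arity L f)"
      "bs \<in> tuples (univ ?H) (fun_arity L f)" for f as bs
  proof -
    have len: "length as = fun_arity L f" "length bs = fun_arity L f"
      using that by (auto simp: tuples_def)
    show ?thesis
      unfolding tdist[OF that(2,3)] unfolding dist decode_elem_fun_int[OF N d that(1) len(1)]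
        decode_elem_fun_int[OF N d that(1) len(2)]
      by (rule lipschitz_structureD(6)[OF N that(1) map_decode_elem_in_tuples[OF d that(2)]
            map_decode_elem_in_tuples[OF d that(3)]])
  qed
  moreover have "univ ?H = UNIV" by (simp add: skolem_hull_def)
  ultimately show ?thesis
    unfolding lipschitz_structure_def one_lipschitz_def image_subset_iff by blast
qed

section \<open>Approximate witnesses and elementarity of the hull\<close>

lemma rat_interval_exists:
  assumes "e > 0"
  shows "\<exists>n. v \<in> rat_interval n \<and> rat_interval n \<subseteq> {v - e <..< v + e}"
proof -
  obtain p q where "v - e < of_rat p" "of_rat p < v" "v < of_rat q" "of_rat q < v + e"
    using of_rat_dense[of "v - e" v] of_rat_dense[of v "v + e"] assms by auto
  then show ?thesis
    by (intro exI[of _ "to_nat (p, q)"]) (auto simp: rat_interval_def)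
qed

text \<open>Exact witnesses for each real value would need uncountably many Skolem functions per
  formula; countably many rational intervals suffice for approximation within every
  \<open>e\<close>.\<close>

lemma skolem_hull_witness:
  assumes d: "d \<in> univ N" and b: "b \<in> univ N" and e: "e > 0"
  shows "\<exists>c. \<bar>eval N ((\<lambda>y. decode_elem N d (s y))(x := decode_elem N d c)) \<phi>
    - eval N ((\<lambda>y. decode_elem N d (s y))(x := b)) \<phi>\<bar> < e"
proof -
  let ?h = "decode_elem N d"
  obtain k where k: "\<forall>y\<in>free_vars \<phi>. y < k"
    using finite_free_vars[of \<phi>] unfolding finite_nat_set_iff_bounded by blast
  define cs where "cs = map s [0..<k]"
  \<comment> \<open>All free variables of \<open>\<phi>\<close> lie below \<open>k\<close>, so
    finitely many codes determine its value and the default \<open>d\<close> beyond the list is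
    never seen.\<close>
  have agree: "eval N ((list_assignment d (map ?h cs))(x := a)) \<phi> = eval N ((\<lambda>y. ?h (s y))(x := a)) \<phi>" for a
    by (rule eval_cong) (use k in \<open>auto simp: list_assignment_def cs_def\<close>)
  obtain n where n: "eval N ((\<lambda>y. ?h (s y))(x := b)) \<phi> \<in> rat_interval n"
    "rat_interval n \<subseteq> {eval N ((\<lambda>y. ?h (s y))(x := b)) \<phi> - e <..< eval N ((\<lambda>y. ?h (s y))(x := b)) \<phi> + e}"
    using rat_interval_exists[OF e] by blast
  define a where "a = skolem N d (Ex n (All x \<phi>)) (map ?h cs)"
  \<comment> \<open>The element \<open>b\<close> itself shows that the choice in
    \<open>skolem\<close> has a witness.\<close>
  have a: "a \<in> univ N \<and> eval N ((\<lambda>y. ?h (s y))(x := a)) \<phi> \<in> rat_interval n"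
    unfolding a_def skolem.simps agree by (rule someI[of _ b]) (use b n in simp)
  then have "?h (And (Ex n (All x \<phi>)) (code_list cs)) = a"
    by (simp add: decode_code_list a_def[symmetric] del: skolem.simps)
  with a n(2) show ?thesis
    by (intro exI[of _ "And (Ex n (All x \<phi>)) (code_list cs)"]) (auto simp: abs_less_iff subset_iff)
qed

text \<open>Here \<open>Y\<close> will be the set of values over all of \<open>N\<close> and
  \<open>X\<close> the set of values over decoded elements.\<close>

lemma Sup_Inf_dense:
  fixes X Y :: "real set"
  assumes XY: "X \<subseteq> Y" and ne: "Y \<noteq> {}" and bdd: "bdd_above Y" "bdd_below Y"
    and dense: "\<And>y e. y \<in> Y \<Longrightarrow> e > 0 \<Longrightarrow> \<exists>x\<in>X. \<bar>x - y\<bar> < e"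
  shows "Sup X = Sup Y" "Inf X = Inf Y"
proof -
  have X: "X \<noteq> {}" using ne dense[of _ 1] by fastforce
  have bddX: "bdd_above X" "bdd_below X"
    using bdd XY by (auto intro: bdd_above_mono bdd_below_mono)
  have "y \<le> Sup X" if "y \<in> Y" for y
  proof (rule field_le_epsilon)
    fix e :: real assume "e > 0"
    with dense that obtain x where x: "x \<in> X" "\<bar>x - y\<bar> < e" by blast
    then show "y \<le> Sup X + e" using cSup_upper[OF x(1) bddX(1)] by linarith
  qed
  then have "Sup Y \<le> Sup X" using ne by (intro cSup_least)
  moreover have "Sup X \<le> Sup Y" by (rule cSup_subset_mono[OF X bdd(1) XY])
  ultimately show "Sup X = Sup Y" by simp
  have "Inf X \<le> y" if "y \<in> Y" for y
  proof (rule field_le_epsilon)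
    fix e :: real assume "e > 0"
    with dense that obtain x where x: "x \<in> X" "\<bar>x - y\<bar> < e" by blast
    then show "Inf X \<le> y + e" using cInf_lower[OF x(1) bddX(2)] by linarith
  qed
  then have "Inf X \<le> Inf Y" using ne by (intro cInf_greatest)
  moreover have "Inf Y \<le> Inf X" by (rule cInf_superset_mono[OF X bdd(2) XY])
  ultimately show "Inf X = Inf Y" by simp
qed

text \<open>A Tarski-Vaught argument with approximate witnesses: the values at decoded elements are
  dense among all values, so suprema and infima agree.\<close>

lemma eval_skolem_hull:
  assumes V: "goedel_set V" "A \<subseteq> V" and N: "lipschitz_structure V L N" and d: "d \<in> univ N"
  shows "wf_fm L A \<phi> \<Longrightarrow> eval (skolem_hull N d) s \<phi> = eval N (\<lambda>y. decode_elem N d (s y)) \<phi>"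
proof (induction \<phi> arbitrary: s)
  case (Atom P ts)
  then have "map (decode_elem N d) (map (eval_tm (skolem_hull N d) s) ts)
      = map (eval_tm N (\<lambda>y. decode_elem N d (s y))) ts"
    using decode_elem_eval_tm[OF N d] by auto
  then show ?case
    unfolding eval.simps by (subst skolem_hull_def) (simp only: struct.simps)
next
  case (All x \<phi>)
  let ?h = "decode_elem N d"
  let ?g = "\<lambda>b. eval N ((\<lambda>y. ?h (s y))(x := b)) \<phi>"
  have upd: "(\<lambda>y. ?h ((s(x := c)) y)) = (\<lambda>y. ?h (s y))(x := ?h c)" for c by auto
  have gV: "?g ` univ N \<subseteq> V"
    by (rule image_subsetI, rule eval_in[OF V N])
      (use All.prems decode_elem_in_univ[OF d] in auto)
  have "Sup (range (\<lambda>c. ?g (?h c))) = Sup (?g ` univ N)"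
    by (rule Sup_Inf_dense(1))
      (use d decode_elem_in_univ[OF d] goedel_set_bdd[OF V(1) gV] skolem_hull_witness[OF d] in auto)
  moreover have "eval (skolem_hull N d) (s(x := c)) \<phi> = ?g (?h c)" for c
    using All.IH[of "s(x := c)"] All.prems by (simp only: upd wf_fm.simps)
  moreover have "univ (skolem_hull N d) = UNIV" by (simp add: skolem_hull_def)
  ultimately show ?case by (simp only: eval.simps)
next
  case (Ex x \<phi>)
  let ?h = "decode_elem N d"
  let ?g = "\<lambda>b. eval N ((\<lambda>y. ?h (s y))(x := b)) \<phi>"
  have upd: "(\<lambda>y. ?h ((s(x := c)) y)) = (\<lambda>y. ?h (s y))(x := ?h c)" for c by auto
  have gV: "?g ` univ N \<subseteq> V"
    by (rule image_subsetI, rule eval_in[OF V N])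
      (use Ex.prems decode_elem_in_univ[OF d] in auto)
  have "Inf (range (\<lambda>c. ?g (?h c))) = Inf (?g ` univ N)"
    by (rule Sup_Inf_dense(2))
      (use d decode_elem_in_univ[OF d] goedel_set_bdd[OF V(1) gV] skolem_hull_witness[OF d] in auto)
  moreover have "eval (skolem_hull N d) (s(x := c)) \<phi> = ?g (?h c)" for c
    using Ex.IH[of "s(x := c)"] Ex.prems by (simp only: upd wf_fm.simps)
  moreover have "univ (skolem_hull N d) = UNIV" by (simp add: skolem_hull_def)
  ultimately show ?case by (simp only: eval.simps)
qed auto

text \<open>The models of finite subsets live in an arbitrary type \<open>'m\<close> and the
  ultraproduct in a function type over it; the hull moves the model to the type of formulas.\<close>

theorem theorem4p8:
  fixes V A :: "real set" and L :: "('f, 'p) lang" and T :: "('f, 'p) fm set"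
  assumes "is_language_d L"
    and "goedel_set V"
    and "limit_points V \<subseteq> {0}"
    and "A = {} \<or> A = V - {0, 1}"
    and "is_theory L A T"
    and "finitely_lipschitz_satisfiable TYPE('m) V L T"
  shows "lipschitz_satisfiable TYPE(('f, 'p) fm) V L T"
proof -
  note V = assms(2,3)
  have A: "A \<subseteq> V" using assms(4) by auto
  \<comment> \<open>The family is indexed by all sets of formulas; where \<open>S\<close> is not a
    finite subset of \<open>T\<close>, a model of the empty theory serves as filler.\<close>
  have "\<exists>M :: ('f, 'p, 'm) struct. lipschitz_structure V L M \<and>
      (finite S \<and> S \<subseteq> T \<longrightarrow> (\<forall>\<phi>\<in>S. models M \<phi>))" for S
    using assms(6) unfolding finitely_lipschitz_satisfiable_def lipschitz_satisfiable_def
    by (metis empty_subsetI finite.emptyI)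
  then obtain M :: "('f, 'p) fm set \<Rightarrow> ('f, 'p, 'm) struct"
    where M: "\<And>S. lipschitz_structure V L (M S)"
      and models: "\<And>S \<phi>. finite S \<Longrightarrow> S \<subseteq> T \<Longrightarrow> \<phi> \<in> S \<Longrightarrow> models (M S) \<phi>"
    by metis
  \<comment> \<open>Refining this filter makes each sentence of \<open>T\<close> belong to almost
    every index \<open>S\<close>, hence hold in almost every factor.\<close>
  obtain F where F: "ultrafilter F" "F \<le> finite_subsets_at_top T"
    using ultrafilter_exists[OF finite_subsets_at_top_neq_bot] by blast
  define N where "N = ultraproduct F M"
  have N: "lipschitz_structure V L N"
    unfolding N_def by (rule lipschitz_structure_ultraproduct[OF assms(1) F(1) V(1) M])
  then obtain d where d: "d \<in> univ N"
    by (auto simp: lipschitz_structure_def)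
  have "models (skolem_hull N d) \<phi>" if \<phi>: "\<phi> \<in> T" for \<phi>
    unfolding models_def
  proof (intro allI impI)
    fix s :: "nat \<Rightarrow> ('f, 'p) fm"
    let ?s = "\<lambda>y. decode_elem N d (s y)"
    have wf: "wf_fm L A \<phi>" using assms(5) \<phi> by (auto simp: is_theory_def is_sentence_def)
    have r: "range ?s \<subseteq> univ N" using decode_elem_in_univ[OF d] by auto
    have "eventually (\<lambda>S. finite S \<and> S \<subseteq> T \<and> \<phi> \<in> S) (finite_subsets_at_top T)"
      unfolding eventually_finite_subsets_at_top using \<phi> by (intro exI[of _ "{\<phi>}"]) auto
    then have "eventually (\<lambda>S. finite S \<and> S \<subseteq> T \<and> \<phi> \<in> S) F"
      using F(2) by (rule filter_leD[rotated])
    then have "eventually (\<lambda>S. eval (M S) (\<lambda>x. ?s x S) \<phi> = 0) F"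
    proof eventually_elim
      case (elim S)
      have "range (\<lambda>x. ?s x S) \<subseteq> univ (M S)"
        using r by (fastforce simp: N_def ultraproduct_def)
      with models elim show ?case by (auto simp: models_def)
    qed
    then have "((\<lambda>S. eval (M S) (\<lambda>x. ?s x S) \<phi>) \<longlongrightarrow> 0) F"
      by (rule tendsto_eventually)
    \<comment> \<open>The same values tend to the value in the ultraproduct, so uniqueness of limits
      makes that value 0.\<close>
    moreover have "((\<lambda>S. eval (M S) (\<lambda>x. ?s x S) \<phi>) \<longlongrightarrow> eval N ?s \<phi>) F"
      unfolding N_def by (rule los[OF assms(1) F(1) V A M r[unfolded N_def] wf])
    ultimately have "eval N ?s \<phi> = 0"
      using F(1) tendsto_unique by (auto simp: ultrafilter_def)
    then show "eval (skolem_hull N d) s \<phi> = 0"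
      by (simp only: eval_skolem_hull[OF V(1) A N d wf])
  qed
  with lipschitz_structure_skolem_hull[OF N d] show ?thesis
    by (auto simp: lipschitz_satisfiable_def)
qed

end
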